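(* Let $n\ge2$, let $\mathcal{G}\subseteq\mathrm{GL}_n(\mathbb{Z})$ be the integer representation of the Weyl group of type $\mathrm{B}_n$ with respect to the fundamental weights, and let $\mathcal{T}$, $\mathcal{T}_{\mathbb{R}}$ be its $\mathbb{T}$-orbit space and real $\mathbb{T}$-orbit space. Put \[ c_i(z)=(-1)^i\binom ni z_i\ (1\le i\le n-1),\qquad c_n(z)=(-1)^n\Big(2^nz_n^2-\sum_{i=1}^{n-1}\binom ni z_i-1\Big) \] in $\mathbb{Q}[z_1,\dots,z_n]$, let \[ C(z)=\begin{bmatrix}0&\cdots&0&-c_n(z)\\1&&0&-c_{n-1}(z)\\&\ddots&&\vdots\\0&&1&-c_1(z)\end{bmatrix}\in\mathbb{Q}[z]^{n\times n} \] be the companion matrix, and define $H\in\mathbb{Q}[z]^{n\times n}$ by $H(z)_{ij}=\mathrm{Tr}\big(C(z)^{i+j-2}-C(z)^{i+j}\big)$. Then \[ \mathcal{T}=\mathcal{T}_{\mathbb{R}}=\{z\in\mathbb{R}^n\mid H(z)\succeq0\}. \]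
   Context: $\mathbb{T}=\{x\in\mathbb{C}\mid|x|=1\}$; $\succeq0$ means positive semidefinite. The matrix $C(z)$ has ones on the first subdiagonal, last column $(-c_n,-c_{n-1},\dots,-c_1)^t$, and zeros elsewhere. The Weyl group $\mathcal{W}\cong\mathfrak{S}_n\ltimes\{\pm1\}^n$ of $\mathrm{B}_n$ acts on $\mathbb{R}^n$ by all signed permutations of coordinates; the fundamental weights are $\omega_i=\epsilon_1+\dots+\epsilon_i$ for $1\le i\le n-1$ and $\omega_n=(\epsilon_1+\dots+\epsilon_n)/2$ ($\epsilon_j$ standard basis vectors of $\mathbb{R}^n$). The integer representation $\mathcal{G}$ is the group of matrices of elements of $\mathcal{W}$ in the basis $\omega_1,\dots,\omega_n$. For $x\in(\mathbb{C}^* )^n$, $\alpha\in\mathbb{Z}^n$, $x^\alpha=\prod x_i^{\alpha_i}$; $\theta_i(x)=\frac1{|\mathcal{G}|}\sum_{B\in\mathcal{G}}x^{Be_i}$ ($e_i$ standard basis of $\mathbb{Z}^n$). The $\mathbb{T}$-orbit space is $\mathcal{T}=\{(\theta_1(x),\dots,\theta_n(x))\mid x\in\mathbb{T}^n\}$. Since $-I_n\in\mathcal{G}$, the $\theta_i$ are real-valued on $\mathbb{T}^n$, and the real $\mathbb{T}$-orbit space $\mathcal{T}_{\mathbb{R}}\subseteq\mathbb{R}^n$ is by definition the image of the same map $x\mapsto(\theta_1(x),\dots,\theta_n(x))$ on $\mathbb{T}^n$. *)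

theory Defs
  imports
    "HOL-Combinatorics.Permutations"
    "Jordan_Normal_Form.Matrix"
begin

text \<open>Vectors and matrices are indexed from 0, so the coordinate \<open>z\<^sub>i\<close> of the
  mathematical text is \<open>z $ (i - 1)\<close>.\<close>

definition fundamental_weight :: "nat \<Rightarrow> nat \<Rightarrow> real vec" where
  "fundamental_weight n i =
     (if i < n then vec n (\<lambda>j. if j < i then 1 else 0) else vec n (\<lambda>j. 1 / 2))"

definition weight_basis :: "nat \<Rightarrow> real mat" where
  "weight_basis n = mat_of_cols n (map (fundamental_weight n) [1..<n+1])"

text \<open>The matrix below sends \<open>\<epsilon>\<^sub>j\<close> to \<open>s j \<cdot> \<epsilon>\<^bsub>p j\<^esub>\<close>.\<close>

definition weyl_group_B :: "nat \<Rightarrow> real mat set" where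
  "weyl_group_B n =
     {mat n n (\<lambda>(i, j). if i = p j then s j else 0) | p s.
        p permutes {..<n} \<and> (\<forall>j<n. s j \<in> {1, -1})}"

text \<open>The equation says that \<open>B\<close> is the matrix of \<open>w\<close> in the basis of fundamental weights:
  column by column, \<open>w \<omega>\<^sub>j = (\<Sum>i. B\<^sub>i\<^sub>j \<omega>\<^sub>i)\<close>.\<close>

definition integer_rep_B :: "nat \<Rightarrow> int mat set" where
  "integer_rep_B n =
     {B \<in> carrier_mat n n.
        \<exists>w \<in> weyl_group_B n. w * weight_basis n = weight_basis n * map_mat real_of_int B}"

definition monomial :: "nat \<Rightarrow> complex vec \<Rightarrow> int vec \<Rightarrow> complex" where
  "monomial n x \<alpha> = (\<Prod>i<n. (x $ i) powi (\<alpha> $ i))"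

definition theta :: "nat \<Rightarrow> nat \<Rightarrow> complex vec \<Rightarrow> complex" where
  "theta n i x =
     (\<Sum>B\<in>integer_rep_B n. monomial n x (B *\<^sub>v unit_vec n (i - 1)))
       / of_nat (card (integer_rep_B n))"

definition theta_map :: "nat \<Rightarrow> complex vec \<Rightarrow> complex vec" where
  "theta_map n x = vec n (\<lambda>i. theta n (i + 1) x)"

definition torus :: "nat \<Rightarrow> complex vec set" where
  "torus n = {x \<in> carrier_vec n. \<forall>i<n. cmod (x $ i) = 1}"

definition orbit_space :: "nat \<Rightarrow> complex vec set" where
  "orbit_space n = theta_map n ` torus n"

text \<open>Since the \<open>\<theta>\<^sub>i\<close> are real-valued on the torus, taking real parts only changes the
  type.\<close>

definition real_orbit_space :: "nat \<Rightarrow> real vec set" where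
  "real_orbit_space n = (\<lambda>x. map_vec Re (theta_map n x)) ` torus n"

text \<open>The polynomials in \<open>z\<close> and the matrices over them are given by their values, uniformly
  over all commutative rings.\<close>

definition coeff_c :: "nat \<Rightarrow> nat \<Rightarrow> 'a::comm_ring_1 vec \<Rightarrow> 'a" where
  "coeff_c n i z =
     (if i < n then (-1) ^ i * of_nat (n choose i) * z $ (i - 1)
      else (-1) ^ n * (2 ^ n * (z $ (n - 1))\<^sup>2
             - (\<Sum>k = 1..n - 1. of_nat (n choose k) * z $ (k - 1)) - 1))"

definition companion_C :: "nat \<Rightarrow> 'a::comm_ring_1 vec \<Rightarrow> 'a mat" where
  "companion_C n z =
     mat n n (\<lambda>(i, j). if j = n - 1 then - coeff_c n (n - i) z
                       else if i = j + 1 then 1 else 0)"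

definition mat_trace :: "'a::comm_monoid_add mat \<Rightarrow> 'a" where
  "mat_trace A = (\<Sum>i<dim_row A. A $$ (i, i))"

text \<open>In 0-based indices the exponents \<open>i + j - 2\<close> and \<open>i + j\<close> become \<open>i + j\<close> and
  \<open>i + j + 2\<close>.\<close>

definition hermite_H :: "nat \<Rightarrow> 'a::comm_ring_1 vec \<Rightarrow> 'a mat" where
  "hermite_H n z =
     mat n n (\<lambda>(i, j). mat_trace (companion_C n z ^\<^sub>m (i + j) - companion_C n z ^\<^sub>m (i + j + 2)))"

definition pos_semidef :: "real mat \<Rightarrow> bool" where
  "pos_semidef A \<longleftrightarrow>
     square_mat A \<and> transpose_mat A = A \<and>
     (\<forall>v \<in> carrier_vec (dim_row A). 0 \<le> v \<bullet> (A *\<^sub>v v))"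

end

theory Submission
  imports Defs "Jordan_Normal_Form.Char_Poly"
begin

text \<open>
  Write the character of \<open>\<epsilon>\<^sub>j\<close> on the torus as \<open>u\<^sub>j\<^sup>2\<close>, with the \<open>u\<^sub>j\<close> chosen so that \<open>\<omega>\<^sub>n\<close> becomes
  \<open>\<Prod>\<^sub>j u\<^sub>j\<close>. Averaging over signs and permutations turns \<open>\<theta>\<^sub>i\<close> for \<open>i < n\<close> into the \<open>i\<close>-th elementary
  symmetric polynomial of the \<open>c\<^sub>j = Re (u\<^sub>j\<^sup>2)\<close>, divided by \<open>n choose i\<close>, and \<open>\<theta>\<^sub>n\<close> into \<open>\<Prod>\<^sub>j Re u\<^sub>j\<close>.
  Because of \<open>2 (Re u\<^sub>j)\<^sup>2 = 1 + c\<^sub>j\<close>, the orbit space consists of the \<open>z\<close> for which the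
  characteristic polynomial of \<open>C(z)\<close> is \<open>\<Prod>\<^sub>j (X - c\<^sub>j)\<close> with all \<open>c\<^sub>j\<close> in \<open>[-1, 1]\<close>; the sign of
  \<open>z\<^sub>n\<close> is adjusted by replacing one \<open>u\<^sub>j\<close> with \<open>- u\<^sub>j\<close>. Finally, \<open>H(z)\<close> is the matrix of the quadratic
  form \<open>q \<mapsto> \<Sum>\<^sub>r (1 - r\<^sup>2) q(r)\<^sup>2\<close>, summed over the eigenvalues \<open>r\<close> of \<open>C(z)\<close>, on real polynomials of
  degree less than \<open>n\<close>, and Hermite's argument shows that it is positive semidefinite if and only
  if all eigenvalues lie in \<open>[-1, 1]\<close>.
\<close>

section \<open>Elementary symmetric polynomials and traces of companion matrices\<close>

text \<open>The variables form an indexed family, so repeated values, such as multiple roots, are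
  counted with multiplicity.\<close>

definition esym :: "'i set \<Rightarrow> nat \<Rightarrow> ('i \<Rightarrow> 'a::comm_ring_1) \<Rightarrow> 'a" where
  "esym A k c = (\<Sum>S | S \<subseteq> A \<and> card S = k. \<Prod>j\<in>S. c j)"

text \<open>Expanding the product chooses a subset of factors contributing \<open>c j\<close>;
  grouping by cardinality gives the claim. This identity explains the shape of the last coefficient
  \<open>coeff_c n n z\<close>.\<close>

lemma prod_one_plus_eq_sum_esym:
  assumes "finite A"
  shows "(\<Prod>j\<in>A. 1 + c j) = (\<Sum>k\<le>card A. esym A k c)"
proof -
  have "(\<Prod>j\<in>A. 1 + c j) = (\<Sum>S\<in>Pow A. \<Prod>j\<in>S. c j)"
    using prod_add[OF assms, of c "\<lambda>_. 1"] by (simp add: add.commute)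
  also have "\<dots> = (\<Sum>k\<le>card A. \<Sum>S\<in>{S \<in> Pow A. card S = k}. \<Prod>j\<in>S. c j)"
    using assms by (intro sum.group[symmetric]) (auto intro: card_mono)
  finally show ?thesis by (simp add: esym_def Pow_def)
qed

lemma esym_0:
  assumes "finite A"
  shows "esym A 0 c = 1"
proof -
  have "{S. S \<subseteq> A \<and> card S = 0} = {{}}"
    using assms finite_subset by fastforce
  then show ?thesis by (simp add: esym_def)
qed

text \<open>Vieta's formulas: taking the constant term from the factors in \<open>S\<close> and
  \<open>X\<close> from the others yields a multiple of \<open>X\<close> to the power
  \<open>card (A - S)\<close>.\<close>

lemma coeff_prod_linear_eq_esym:
  fixes c :: "'i \<Rightarrow> 'a::comm_ring_1"
  assumes "finite A" and "i \<le> card A"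
  shows "coeff (\<Prod>j\<in>A. [:- c j, 1:]) i = (- 1) ^ (card A - i) * esym A (card A - i) c"
proof -
  have pC: "(\<Prod>j\<in>S. [:- c j:]) = [:(- 1) ^ card S * (\<Prod>j\<in>S. c j):]" for S
    by (induct S rule: infinite_finite_induct) (auto simp: one_pCons algebra_simps)
  have "(\<Prod>j\<in>A. [:- c j, 1:]) = (\<Prod>j\<in>A. [:- c j:] + [:0, 1:])"
    by simp
  also have "\<dots> = (\<Sum>S\<in>Pow A. monom ((- 1) ^ card S * (\<Prod>j\<in>S. c j)) (card (A - S)))"
    by (subst prod_add[OF assms(1)]) (simp add: pC monom_altdef)
  finally have "coeff (\<Prod>j\<in>A. [:- c j, 1:]) i =
      (\<Sum>S\<in>Pow A. if card (A - S) = i then (- 1) ^ card S * (\<Prod>j\<in>S. c j) else 0)"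
    by (simp add: coeff_sum)
  also have "\<dots> = (\<Sum>S\<in>{S \<in> Pow A. card (A - S) = i}. (- 1) ^ card S * (\<Prod>j\<in>S. c j))"
    using assms(1) by (subst sum.inter_filter) auto
  also have "{S \<in> Pow A. card (A - S) = i} = {S. S \<subseteq> A \<and> card S = card A - i}"
    using assms by (auto simp: card_Diff_subset finite_subset card_mono)
  finally show ?thesis
    by (simp add: esym_def sum_distrib_left)
qed

section \<open>Traces of powers of the companion matrix\<close>

lemma mat_trace_mult_commute:
  fixes A :: "'a::comm_ring_1 mat"
  assumes "A \<in> carrier_mat n m" and "B \<in> carrier_mat m n"
  shows "mat_trace (A * B) = mat_trace (B * A)"
proof -
  have "mat_trace (A * B) = (\<Sum>i<n. \<Sum>j<m. A $$ (i, j) * B $$ (j, i))"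
    using assms by (simp add: mat_trace_def scalar_prod_def atLeast0LessThan)
  also have "\<dots> = (\<Sum>j<m. \<Sum>i<n. B $$ (j, i) * A $$ (i, j))"
    by (subst sum.swap) (simp add: mult.commute)
  finally show ?thesis
    using assms by (simp add: mat_trace_def scalar_prod_def atLeast0LessThan)
qed

lemma mat_trace_pow_similar:
  fixes A :: "'a::comm_ring_1 mat"
  assumes "similar_mat_wit A B P Q"
  shows "mat_trace (A ^\<^sub>m k) = mat_trace (B ^\<^sub>m k)"
proof -
  obtain n where c: "A \<in> carrier_mat n n" "B \<in> carrier_mat n n" "P \<in> carrier_mat n n"
      "Q \<in> carrier_mat n n" and QP: "Q * P = 1\<^sub>m n"
    using similar_mat_witD[OF refl assms] by blast
  have "mat_trace (A ^\<^sub>m k) = mat_trace (P * (B ^\<^sub>m k * Q))"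
    using similar_mat_wit_pow_id[OF assms] c
    by (metis assoc_mult_mat pow_carrier_mat)
  also have "\<dots> = mat_trace (B ^\<^sub>m k * Q * P)"
    using c by (intro mat_trace_mult_commute[where n = n and m = n]) auto
  also have "B ^\<^sub>m k * Q * P = B ^\<^sub>m k"
    using c QP by (metis assoc_mult_mat pow_carrier_mat right_mult_one_mat)
  finally show ?thesis .
qed

definition bidiagonal :: "nat \<Rightarrow> (nat \<Rightarrow> 'a::comm_ring_1) \<Rightarrow> 'a mat" where
  "bidiagonal n r = mat n n (\<lambda>(i, j). if i = j then r j else if i = j + 1 then 1 else 0)"

lemma sum_bidiagonal:
  fixes f :: "nat \<Rightarrow> 'a::comm_ring_1"
  assumes "j < n"
  shows "(\<Sum>l<n. f l * (if l = j then r j else if l = j + 1 then 1 else 0))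
    = f j * r j + (if j + 1 < n then f (j + 1) else 0)"
proof -
  have "(\<Sum>l<n. f l * (if l = j then r j else if l = j + 1 then 1 else 0))
      = (\<Sum>l<n. (if l = j then f j * r j else 0) + (if l = j + 1 then f (j + 1) else 0))"
    by (rule sum.cong) auto
  then show ?thesis using assms by (simp add: sum.distrib)
qed

lemma mult_bidiagonal_index:
  assumes "A \<in> carrier_mat m n" and "i < m" and "j < n"
  shows "(A * bidiagonal n r) $$ (i, j)
    = A $$ (i, j) * r j + (if j + 1 < n then A $$ (i, j + 1) else 0)"
proof -
  have "(A * bidiagonal n r) $$ (i, j)
      = (\<Sum>l<n. A $$ (i, l) * (if l = j then r j else if l = j + 1 then 1 else 0))"
    using assms by (auto simp: bidiagonal_def scalar_prod_def atLeast0LessThan intro!: sum.cong)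
  then show ?thesis by (simp only: sum_bidiagonal[OF assms(3), of "\<lambda>l. A $$ (i, l)"])
qed

text \<open>Powers of a lower triangular matrix stay lower triangular. The induction covers exactly
  the entries with \<open>i \<le> j\<close>, since right multiplication by
  \<open>bidiagonal n r\<close> only involves the entries \<open>(i, j)\<close> and
  \<open>(i, j + 1)\<close>.\<close>

lemma mat_trace_bidiagonal_pow:
  "mat_trace (bidiagonal n r ^\<^sub>m k) = (\<Sum>j<n. r j ^ k)"
proof -
  let ?T = "bidiagonal n r"
  have T: "?T \<in> carrier_mat n n" by (simp add: bidiagonal_def)
  have "\<forall>i j. i \<le> j \<longrightarrow> j < n \<longrightarrow> (?T ^\<^sub>m k) $$ (i, j) = (if i = j then r j ^ k else 0)"
  proof (induct k)
    case 0
    then show ?case using T by auto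
  next
    case (Suc k)
    show ?case
    proof (intro allI impI)
      fix i j assume ij: "i \<le> j" "j < n"
      have "(?T ^\<^sub>m Suc k) $$ (i, j) = (?T ^\<^sub>m k) $$ (i, j) * r j
          + (if j + 1 < n then (?T ^\<^sub>m k) $$ (i, j + 1) else 0)"
        using ij T mult_bidiagonal_index[of "?T ^\<^sub>m k" n n i j r] by simp
      then show "(?T ^\<^sub>m Suc k) $$ (i, j) = (if i = j then r j ^ Suc k else 0)"
        using Suc ij by simp
    qed
  qed
  then show ?thesis using T by (simp add: mat_trace_def)
qed

text \<open>In the Newton basis \<open>\<Prod>\<^bsub>j < k\<^esub> (X - r\<^sub>j)\<close> of the polynomials modulo the
  characteristic polynomial, multiplication by \<open>X\<close> is bidiagonal; this also covers repeated
  roots.\<close>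

lemma mat_trace_companion_pow:
  fixes r :: "nat \<Rightarrow> 'a::field"
  assumes "n > 0"
    and z: "\<And>k. 1 \<le> k \<Longrightarrow> k \<le> n \<Longrightarrow> coeff_c n k z = (- 1) ^ k * esym {..<n} k r"
  shows "mat_trace (companion_C n z ^\<^sub>m k) = (\<Sum>j<n. r j ^ k)"
proof -
  \<comment> \<open>Column \<open>k\<close> of \<open>P\<close> holds the coefficients of the Newton
    polynomial \<open>g k\<close>; the aim is that \<open>P\<close> conjugates \<open>?T\<close>
    into \<open>?C\<close>.\<close>
  define g where "g k = (\<Prod>j<k. [:- r j, 1:])" for k
  define P where "P = mat n n (\<lambda>(i, k). coeff (g k) i)"
  let ?C = "companion_C n z" and ?T = "bidiagonal n r"
  have f: "coeff (g n) i = coeff_c n (n - i) z" if "i < n" for i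
    using that by (simp add: g_def coeff_prod_linear_eq_esym z)
  have deg: "degree (g k) = k" for k
    unfolding g_def by (subst degree_prod_eq_sum_degree) auto
  have lead: "coeff (g k) k = 1" for k
    by (induct k) (auto simp: g_def coeff_eq_0 deg[unfolded g_def])
  have step: "pCons 0 (g k) = g (Suc k) + smult (r k) (g k)" for k
    by (simp add: g_def algebra_simps)
  have car: "P \<in> carrier_mat n n" "?C \<in> carrier_mat n n" "?T \<in> carrier_mat n n"
    by (auto simp: P_def companion_C_def bidiagonal_def)
  have CP: "?C * P = P * ?T"
  proof (rule eq_matI)
    fix i k assume "i < dim_row (P * ?T)" "k < dim_col (P * ?T)"
    then have ik: "i < n" "k < n" using car by auto
    have "(?C * P) $$ (i, k) = (\<Sum>l<n. ?C $$ (i, l) * coeff (g k) l)"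
      using ik car by (auto simp: scalar_prod_def atLeast0LessThan P_def intro!: sum.cong)
    \<comment> \<open>Row \<open>i\<close> of \<open>?C\<close> has entries only in the last column
      and in column \<open>i - 1\<close>; the guard \<open>i > 0\<close> handles the truncated
      subtraction.\<close>
    also have "\<dots> = (\<Sum>l<n. (if l = n - 1 then - coeff_c n (n - i) z * coeff (g k) (n - 1) else 0)
        + (if l = i - 1 then (if i > 0 then coeff (g k) (i - 1) else 0) else 0))"
      using ik by (intro sum.cong) (auto simp: companion_C_def)
    also have "\<dots> = coeff (pCons 0 (g k)) i - coeff_c n (n - i) z * coeff (g k) (n - 1)"
      using ik by (simp add: sum.distrib coeff_pCons split: nat.split)
    \<comment> \<open>Multiplication by \<open>X\<close> modulo \<open>g n\<close>: for
      \<open>k + 1 < n\<close> the degree of \<open>g k\<close> is too small for a reduction, and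
      for \<open>k = n - 1\<close> the reduction removes exactly the summand
      \<open>g n\<close>.\<close>
    also have "\<dots> = coeff (g k) i * r k + (if k + 1 < n then coeff (g (k + 1)) i else 0)"
    proof (cases "k + 1 < n")
      case True
      then show ?thesis by (simp add: step coeff_eq_0 deg)
    next
      case False
      then have n: "n = Suc k" using ik by simp
      have "coeff_c n (n - i) z * coeff (g k) (n - 1) = coeff (g n) i"
        using lead[of k] f[OF ik(1)] by (simp add: n)
      moreover have "coeff (pCons 0 (g k)) i = coeff (g n) i + r k * coeff (g k) i"
        by (simp add: step n)
      ultimately show ?thesis using False by simp
    qed
    also have "\<dots> = (P * ?T) $$ (i, k)"
      using ik car by (subst mult_bidiagonal_index[where m = n]) (auto simp: P_def)
    finally show "(?C * P) $$ (i, k) = (P * ?T) $$ (i, k)" .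
  qed (use car in auto)
  \<comment> \<open>The \<open>g k\<close> are monic of degree \<open>k\<close>, so \<open>P\<close>
    is unitriangular and hence invertible.\<close>
  have "upper_triangular P"
    by (auto simp: P_def deg coeff_eq_0)
  then have "det P = prod_list (diag_mat P)"
    using car by (intro det_upper_triangular)
  also have "diag_mat P = map (\<lambda>_. 1) [0..<n]"
    by (auto simp: diag_mat_def P_def lead)
  finally have "det P \<noteq> 0" by (simp add: map_replicate_const)
  then have "P \<in> Units (ring_mat TYPE('a) n ())"
    by (rule det_non_zero_imp_unit[OF car(1)])
  then obtain Q where Q: "Q \<in> carrier_mat n n" "Q * P = 1\<^sub>m n" "P * Q = 1\<^sub>m n"
    by (auto simp: Units_def ring_mat_def)
  have "P * ?T * Q = ?C * (P * Q)"
    unfolding CP[symmetric] using car Q(1) by (intro assoc_mult_mat) auto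
  then have "?C = P * ?T * Q"
    using car(2) by (simp add: Q(3))
  then have "similar_mat_wit ?C ?T P Q"
    using similar_mat_witI[OF Q(3) Q(2)] car Q(1) by blast
  then show ?thesis
    by (simp add: mat_trace_pow_similar mat_trace_bidiagonal_pow)
qed

section \<open>Hermite's root criterion\<close>

text \<open>The \<open>r j\<close> are the complex roots of the characteristic polynomial of
  \<open>companion_C n z\<close>, whose coefficient at \<open>X^i\<close> is
  \<open>coeff_c n (n - i) z\<close>.\<close>

lemma coeff_c_eq_esym_ex:
  fixes z :: "complex vec"
  assumes "n > 0"
  shows "\<exists>r. \<forall>k. 1 \<le> k \<longrightarrow> k \<le> n \<longrightarrow> coeff_c n k z = (- 1) ^ k * esym {..<n} k r"
proof -
  define p where "p = monom 1 n + (\<Sum>i<n. monom (coeff_c n (n - i) z) i)"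
  have co: "coeff p i = (if i = n then 1 else if i < n then coeff_c n (n - i) z else 0)" for i
    by (auto simp: p_def coeff_sum)
  have "degree p = n"
    by (intro antisym degree_le le_degree) (auto simp: co)
  obtain as where "smult (coeff p (degree p)) (\<Prod>a\<leftarrow>as. [:- a, 1:]) = p" and len: "length as = degree p"
    using fundamental_theorem_algebra_factorized by blast
  then have "(\<Prod>a\<leftarrow>as. [:- a, 1:]) = p"
    by (simp add: co \<open>degree p = n\<close>)
  then have p: "p = (\<Prod>j<n. [:- as ! j, 1:])"
    using len \<open>degree p = n\<close> by (simp add: prod.list_conv_set_nth atLeast0LessThan)
  have "coeff_c n k z = (- 1) ^ k * esym {..<n} k ((!) as)" if "1 \<le> k" "k \<le> n" for k
  proof -
    have "coeff_c n k z = coeff p (n - k)"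
      using that by (simp add: co)
    then show ?thesis
      using that unfolding p by (simp add: coeff_prod_linear_eq_esym)
  qed
  then show ?thesis by blast
qed

section \<open>The quadratic form of \<open>hermite_H\<close> in terms of the roots\<close>

lemma esym_of_real: "esym A k (\<lambda>j. of_real (c j)) = of_real (esym A k c)"
  by (simp add: esym_def)

lemma coeff_c_of_real:
  assumes "dim_vec z = n" and "k \<ge> 1" and "k \<le> n"
  shows "coeff_c n k (map_vec complex_of_real z) = of_real (coeff_c n k z)"
proof -
  have "(\<Sum>i = 1..n - 1. of_nat (n choose i) * map_vec complex_of_real z $ (i - 1))
     = of_real (\<Sum>i = 1..n - 1. of_nat (n choose i) * z $ (i - 1))"
    using assms by (auto intro!: sum.cong)
  then show ?thesis
    using assms unfolding coeff_c_def by (cases "k < n") simp_all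
qed

text \<open>The roots may be nonreal even for real \<open>z\<close>, so the form is evaluated over
  the complex numbers and transferred back.\<close>

lemma hermite_H_of_real:
  assumes "dim_vec z = n"
  shows "hermite_H n (map_vec complex_of_real z) = map_mat of_real (hermite_H n z)"
proof -
  have C: "companion_C n (map_vec complex_of_real z) = map_mat of_real (companion_C n z)"
    by (rule eq_matI) (auto simp: companion_C_def coeff_c_of_real assms)
  have car: "companion_C n z \<in> carrier_mat n n"
    by (simp add: companion_C_def)
  have tr: "mat_trace (map_mat of_real A) = of_real (mat_trace A)"
    if "A \<in> carrier_mat n n" for A :: "real mat"
    using that by (simp add: mat_trace_def)
  have tr2: "mat_trace (A - B) = mat_trace A - mat_trace B"
    if "A \<in> carrier_mat n n" "B \<in> carrier_mat n n" for A B :: "'a::comm_ring_1 mat"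
    using that by (simp add: mat_trace_def sum_subtractf)
  show ?thesis
    by (rule eq_matI)
      (auto simp: hermite_H_def C tr2 tr car of_real_hom.mat_hom_pow[OF car, symmetric] simp del: pow_mat.simps)
qed

text \<open>The entries are differences of power sums, so the matrix factors as
  \<open>V^T D V\<close> with the Vandermonde matrix \<open>V\<close> of the roots and
  \<open>D\<close> diagonal with entries \<open>1 - (r j)^2\<close>.\<close>

lemma hermite_H_quadratic_form:
  fixes r :: "nat \<Rightarrow> 'a::field"
  assumes "n > 0"
    and z: "\<And>k. 1 \<le> k \<Longrightarrow> k \<le> n \<Longrightarrow> coeff_c n k z = (- 1) ^ k * esym {..<n} k r"
    and v: "v \<in> carrier_vec n"
  shows "v \<bullet> (hermite_H n z *\<^sub>v v) = (\<Sum>j<n. (1 - (r j)\<^sup>2) * (\<Sum>i<n. v $ i * r j ^ i)\<^sup>2)"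
proof -
  have car: "companion_C n z \<in> carrier_mat n n"
    by (simp add: companion_C_def)
  have H: "hermite_H n z $$ (i, k) = (\<Sum>j<n. (1 - (r j)\<^sup>2) * r j ^ i * r j ^ k)"
    if "i < n" "k < n" for i k
  proof -
    have "hermite_H n z $$ (i, k)
        = mat_trace (companion_C n z ^\<^sub>m (i + k)) - mat_trace (companion_C n z ^\<^sub>m (i + k + 2))"
      using that car by (simp add: hermite_H_def mat_trace_def sum_subtractf)
    also have "\<dots> = (\<Sum>j<n. r j ^ (i + k)) - (\<Sum>j<n. r j ^ (i + k + 2))"
      by (simp only: mat_trace_companion_pow[where r = r, OF assms(1) z])
    finally show ?thesis
      by (simp add: sum_subtractf[symmetric] algebra_simps power_add power2_eq_square)
  qed
  have "v \<bullet> (hermite_H n z *\<^sub>v v) = (\<Sum>i<n. v $ i * (\<Sum>k<n. hermite_H n z $$ (i, k) * v $ k))"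
    using v by (simp add: scalar_prod_def atLeast0LessThan hermite_H_def)
  also have "\<dots> = (\<Sum>i<n. \<Sum>k<n. \<Sum>j<n. (1 - (r j)\<^sup>2) * ((v $ i * r j ^ i) * (v $ k * r j ^ k)))"
    by (simp add: H sum_distrib_left sum_distrib_right algebra_simps)
  also have "\<dots> = (\<Sum>i<n. \<Sum>j<n. \<Sum>k<n. (1 - (r j)\<^sup>2) * ((v $ i * r j ^ i) * (v $ k * r j ^ k)))"
    by (intro sum.cong refl sum.swap)
  also have "\<dots> = (\<Sum>j<n. \<Sum>i<n. \<Sum>k<n. (1 - (r j)\<^sup>2) * ((v $ i * r j ^ i) * (v $ k * r j ^ k)))"
    by (rule sum.swap)
  also have "\<dots> = (\<Sum>j<n. (1 - (r j)\<^sup>2) * (\<Sum>i<n. v $ i * r j ^ i)\<^sup>2)"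
    by (simp only: power2_eq_square sum_product) (simp only: sum_distrib_left)
  finally show ?thesis .
qed

lemma of_real_quadratic_form:
  assumes "M \<in> carrier_mat n n" and "v \<in> carrier_vec n"
  shows "of_real (v \<bullet> (M *\<^sub>v v)) = map_vec of_real v \<bullet> (map_mat of_real M *\<^sub>v map_vec of_real v)"
  using assms by (simp add: scalar_prod_def)

section \<open>Positive semidefiniteness and the location of the roots\<close>

lemma poly_eq_sum_lessThan:
  fixes q :: "'a::comm_semiring_1 poly"
  assumes "degree q < n"
  shows "poly q x = (\<Sum>i<n. coeff q i * x ^ i)"
proof -
  have "poly q x = (\<Sum>i\<le>degree q. coeff q i * x ^ i)"
    by (rule poly_altdef)
  also have "\<dots> = (\<Sum>i<n. coeff q i * x ^ i)"
    using assms by (intro sum.mono_neutral_left) (auto simp: coeff_eq_0)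
  finally show ?thesis .
qed

text \<open>The test vector consists of twice the real parts of the coefficients of a Lagrange
  interpolant \<open>q\<close> supported at \<open>w\<close>: its polynomial is \<open>q(X) + cnj (q (cnj X))\<close>, which takes a
  freely chosen value at a nonreal \<open>w\<close> and the conjugate value at \<open>cnj w\<close>.\<close>

lemma real_root_of_pos_semidef:
  fixes z :: "real vec" and r :: "nat \<Rightarrow> complex"
  assumes "n > 0" and dim: "dim_vec z = n"
    and z: "\<And>k. 1 \<le> k \<Longrightarrow> k \<le> n \<Longrightarrow>
      coeff_c n k (map_vec of_real z) = (- 1) ^ k * esym {..<n} k r"
    and psd: "pos_semidef (hermite_H n z)"
    and "m < n"
  shows "r m \<in> \<real>" and "\<bar>Re (r m)\<bar> \<le> 1"
proof -
  define w where "w = r m"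
  define R where "R = r ` {..<n}"
  define p where "p = (\<Prod>j<n. [:- r j, 1:])"
  have "finite R" "w \<in> R" using \<open>m < n\<close> by (auto simp: R_def w_def)
  have roots: "poly p x = 0 \<longleftrightarrow> x \<in> R" for x
    by (auto simp: p_def poly_prod R_def)
  \<comment> \<open>Below degree \<open>n\<close> the coefficients are values of
    \<open>coeff_c\<close> at a real vector. Hence the set of roots is closed under
    conjugation.\<close>
  have "coeff p i \<in> \<real>" for i
  proof (cases "i < n")
    case True
    then have "coeff p i = coeff_c n (n - i) (map_vec of_real z)"
      by (simp add: p_def coeff_prod_linear_eq_esym z)
    then show ?thesis using True dim by (simp add: coeff_c_of_real)
  next
    case False
    have "degree p = n" unfolding p_def by (subst degree_prod_eq_sum_degree) auto
    moreover have "lead_coeff p = 1" unfolding p_def by (simp add: lead_coeff_prod)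
    ultimately show ?thesis using False by (cases "i = n") (auto simp: coeff_eq_0)
  qed
  then have cnjR: "cnj x \<in> R" if "x \<in> R" for x
    using that roots poly_cnj_real by (metis complex_cnj_zero)
  have form: "0 \<le> (\<Sum>j<n. Re ((1 - (r j)\<^sup>2) * (poly q (r j) + cnj (poly q (cnj (r j))))\<^sup>2))"
    if "degree q < n" for q
  proof -
    define v where "v = vec n (\<lambda>i. 2 * Re (coeff q i))"
    let ?v = "map_vec complex_of_real v"
    have "v \<in> carrier_vec n" by (simp add: v_def)
    have val: "(\<Sum>i<n. ?v $ i * x ^ i) = poly q x + cnj (poly q (cnj x))" for x
    proof -
      have "(\<Sum>i<n. ?v $ i * x ^ i) = (\<Sum>i<n. coeff q i * x ^ i + cnj (coeff q i) * x ^ i)"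
        by (intro sum.cong)
          (auto simp: v_def complex_add_cnj distrib_right[symmetric])
      then show ?thesis using that by (simp add: poly_eq_sum_lessThan sum.distrib)
    qed
    have "complex_of_real (v \<bullet> (hermite_H n z *\<^sub>v v))
        = ?v \<bullet> (hermite_H n (map_vec complex_of_real z) *\<^sub>v ?v)"
      unfolding hermite_H_of_real[OF dim]
      by (rule of_real_quadratic_form[where n = n]) (auto simp: hermite_H_def v_def)
    also have "\<dots> = (\<Sum>j<n. (1 - (r j)\<^sup>2) * (\<Sum>i<n. ?v $ i * r j ^ i)\<^sup>2)"
      using \<open>v \<in> carrier_vec n\<close> by (intro hermite_H_quadratic_form[OF assms(1) z]) auto
    also have "\<dots> = (\<Sum>j<n. (1 - (r j)\<^sup>2) * (poly q (r j) + cnj (poly q (cnj (r j))))\<^sup>2)"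
      by (simp only: val)
    finally have "v \<bullet> (hermite_H n z *\<^sub>v v)
        = Re (\<Sum>j<n. (1 - (r j)\<^sup>2) * (poly q (r j) + cnj (poly q (cnj (r j))))\<^sup>2)"
      by (metis Re_complex_of_real)
    moreover have "0 \<le> v \<bullet> (hermite_H n z *\<^sub>v v)"
      using psd by (auto simp: pos_semidef_def hermite_H_def v_def)
    ultimately show ?thesis by (simp add: Re_sum)
  qed
  \<comment> \<open>Interpolation takes place on the set \<open>R\<close> of distinct roots, which
    keeps the degree below \<open>n\<close> also for multiple roots.\<close>
  have interp: "\<exists>q. degree q < n \<and> poly q w = l \<and> (\<forall>x\<in>R - {w}. poly q x = 0)" for l
  proof (intro exI conjI ballI)
    let ?g = "\<Prod>x\<in>R - {w}. [:- x, 1:]"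
    let ?q = "smult (l / (\<Prod>x\<in>R - {w}. w - x)) ?g"
    have "degree ?q \<le> card (R - {w})"
      by (rule order_trans[OF degree_smult_le]) (subst degree_prod_eq_sum_degree, auto)
    also have "\<dots> < card R"
      using \<open>finite R\<close> \<open>w \<in> R\<close> by (rule card_Diff1_less)
    also have "card R \<le> n"
      unfolding R_def using card_image_le[of "{..<n}" r] by simp
    finally show "degree ?q < n" .
    show "poly ?q w = l"
      using \<open>finite R\<close> by (simp add: poly_prod)
    show "poly ?q x = 0" if "x \<in> R - {w}" for x
      using \<open>finite R\<close> that by (auto simp: poly_prod)
  qed
  have real: "w \<in> \<real>"
  proof (rule ccontr)
    assume "w \<notin> \<real>"
    then have "cnj w \<noteq> w" by (metis Reals_cnj_iff)
    have "w\<^sup>2 \<noteq> 1" using \<open>w \<notin> \<real>\<close> by (auto simp: power2_eq_1_iff)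
    \<comment> \<open>With this value the term at \<open>w\<close> equals \<open>- 1\<close>; the
      term at \<open>cnj w\<close> is its conjugate, and all other roots contribute
      \<open>0\<close>.\<close>
    define l where "l = csqrt (- 1 / (1 - w\<^sup>2))"
    have l: "(1 - w\<^sup>2) * l\<^sup>2 = - 1"
      using \<open>w\<^sup>2 \<noteq> 1\<close> by (simp add: l_def)
    obtain q where q: "degree q < n" "poly q w = l" "\<And>x. x \<in> R \<Longrightarrow> x \<noteq> w \<Longrightarrow> poly q x = 0"
      using interp[of l] by auto
    let ?t = "\<lambda>x. Re ((1 - x\<^sup>2) * (poly q x + cnj (poly q (cnj x)))\<^sup>2)"
    have tw: "?t w = - 1"
      using q \<open>cnj w \<noteq> w\<close> cnjR[OF \<open>w \<in> R\<close>] l by simp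
    have "?t x \<le> 0" if "x \<in> R" for x
    proof -
      consider "x = w" | "x = cnj w" | "x \<noteq> w" "cnj x \<noteq> w"
        by (metis complex_cnj_cnj)
      then show ?thesis
      proof cases
        case 2
        have "(1 - x\<^sup>2) * (poly q x + cnj (poly q (cnj x)))\<^sup>2 = cnj ((1 - w\<^sup>2) * l\<^sup>2)"
          using 2 q \<open>cnj w \<noteq> w\<close> cnjR[OF \<open>w \<in> R\<close>] by simp
        then show ?thesis by (simp only: l) simp
      qed (use tw q that cnjR in auto)
    qed
    then have "(\<Sum>j<n. ?t (r j)) < (\<Sum>j<n. 0)"
      using tw \<open>m < n\<close> by (intro sum_strict_mono_ex1) (auto simp: R_def w_def intro!: bexI[of _ m])
    then show False using form[OF q(1)] by simp
  qed
  have "\<bar>Re w\<bar> \<le> 1"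
  proof (rule ccontr)
    assume "\<not> \<bar>Re w\<bar> \<le> 1"
    then have gt: "(Re w)\<^sup>2 > 1" by (simp add: abs_square_le_1 not_le[symmetric])
    \<comment> \<open>For real \<open>w\<close> the symmetrised polynomial takes the value
      \<open>2\<close> at \<open>w\<close> and vanishes at all other roots, leaving only copies of
      the negative term \<open>4 * (1 - w^2)\<close>.\<close>
    obtain q where q: "degree q < n" "poly q w = 1" "\<And>x. x \<in> R \<Longrightarrow> x \<noteq> w \<Longrightarrow> poly q x = 0"
      using interp[of 1] by auto
    let ?t = "\<lambda>x. Re ((1 - x\<^sup>2) * (poly q x + cnj (poly q (cnj x)))\<^sup>2)"
    have "cnj w = w" using real Reals_cnj_iff by blast
    then have tw: "?t w < 0"
      using q gt real by (auto simp: complex_is_Real_iff power2_eq_square)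
    have "?t x \<le> 0" if "x \<in> R" for x
    proof (cases "x = w")
      case False
      then have "cnj x \<noteq> w" using \<open>cnj w = w\<close> by (metis complex_cnj_cnj)
      then show ?thesis using False q that cnjR by simp
    qed (use tw in simp)
    then have "(\<Sum>j<n. ?t (r j)) < (\<Sum>j<n. 0)"
      using tw \<open>m < n\<close> by (intro sum_strict_mono_ex1) (auto simp: R_def w_def intro!: bexI[of _ m])
    then show False using form[OF q(1)] by simp
  qed
  with real show "r m \<in> \<real>" and "\<bar>Re (r m)\<bar> \<le> 1"
    by (simp_all add: w_def)
qed

text \<open>The right side says that the characteristic polynomial of \<open>companion_C n z\<close>
  splits with all roots in \<open>[-1, 1]\<close>. In that case the form is a sum of squares with
  weights \<open>1 - (c j)^2 \<ge> 0\<close>.\<close>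

lemma pos_semidef_hermite_H_iff:
  fixes z :: "real vec"
  assumes "n > 0" and dim: "dim_vec z = n"
  shows "pos_semidef (hermite_H n z) \<longleftrightarrow>
    (\<exists>c. (\<forall>j<n. \<bar>c j\<bar> \<le> 1) \<and>
      (\<forall>k. 1 \<le> k \<longrightarrow> k \<le> n \<longrightarrow> coeff_c n k z = (- 1) ^ k * esym {..<n} k c))"
proof
  assume psd: "pos_semidef (hermite_H n z)"
  obtain r where r: "\<And>k. 1 \<le> k \<Longrightarrow> k \<le> n \<Longrightarrow>
      coeff_c n k (map_vec of_real z) = (- 1) ^ k * esym {..<n} k (r :: nat \<Rightarrow> complex)"
    using coeff_c_eq_esym_ex[OF assms(1)] by blast
  have root: "r j \<in> \<real>" "\<bar>Re (r j)\<bar> \<le> 1" if "j < n" for j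
    by (rule real_root_of_pos_semidef[OF assms _ psd that]; rule r; assumption)+
  define c where "c j = Re (r j)" for j
  have rc: "r j = of_real (c j)" if "j < n" for j
    using root(1)[OF that] by (simp add: c_def)
  have "coeff_c n k z = (- 1) ^ k * esym {..<n} k c" if "1 \<le> k" "k \<le> n" for k
  proof -
    have "esym {..<n} k r = esym {..<n} k (\<lambda>j. of_real (c j))"
      unfolding esym_def by (intro sum.cong prod.cong) (auto simp: rc)
    then have "complex_of_real (coeff_c n k z) = of_real ((- 1) ^ k * esym {..<n} k c)"
      using r[OF that] that dim by (simp add: coeff_c_of_real esym_of_real)
    then show ?thesis by (simp only: of_real_eq_iff)
  qed
  moreover have "\<forall>j<n. \<bar>c j\<bar> \<le> 1" using root(2) by (simp add: c_def)
  ultimately show "\<exists>c. (\<forall>j<n. \<bar>c j\<bar> \<le> 1) \<and>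
      (\<forall>k. 1 \<le> k \<longrightarrow> k \<le> n \<longrightarrow> coeff_c n k z = (- 1) ^ k * esym {..<n} k c)"
    by blast
next
  assume "\<exists>c. (\<forall>j<n. \<bar>c j\<bar> \<le> 1) \<and>
      (\<forall>k. 1 \<le> k \<longrightarrow> k \<le> n \<longrightarrow> coeff_c n k z = (- 1) ^ k * esym {..<n} k c)"
  then obtain c where c: "\<And>j. j < n \<Longrightarrow> \<bar>c j\<bar> \<le> 1"
    "\<And>k. 1 \<le> k \<Longrightarrow> k \<le> n \<Longrightarrow> coeff_c n k z = (- 1) ^ k * esym {..<n} k c"
    by blast
  have "0 \<le> v \<bullet> (hermite_H n z *\<^sub>v v)" if "v \<in> carrier_vec n" for v
    unfolding hermite_H_quadratic_form[where r = c, OF assms(1) c(2) that, simplified]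
    using c(1) by (intro sum_nonneg mult_nonneg_nonneg) (auto simp: abs_square_le_1)
  moreover have "transpose_mat (hermite_H n z) = hermite_H n z"
    by (rule eq_matI) (auto simp: hermite_H_def add.commute)
  ultimately show "pos_semidef (hermite_H n z)"
    by (auto simp: pos_semidef_def hermite_H_def)
qed

section \<open>The integer representation and its orbit sums\<close>

text \<open>Glue a bijection from \<open>S\<close> to \<open>T\<close> with one between the
  complements, which also have equal cardinality.\<close>

lemma permutes_image_eq_ex:
  assumes "finite A" and "S \<subseteq> A" and "T \<subseteq> A" and "card S = card T"
  shows "\<exists>q. q permutes A \<and> q ` S = T"
proof -
  have fin: "finite S" "finite T" using assms finite_subset by auto
  obtain f where f: "bij_betw f S T"
    using finite_same_card_bij fin assms(4) by blast
  have "card (A - S) = card (A - T)"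
    using assms fin by (simp add: card_Diff_subset)
  then obtain g where g: "bij_betw g (A - S) (A - T)"
    using finite_same_card_bij assms(1) by blast
  define q where "q x = (if x \<in> S then f x else if x \<in> A then g x else x)" for x
  have qS: "bij_betw q S T"
    using f by (subst bij_betw_cong[of _ _ f]) (auto simp: q_def)
  have "bij_betw q (A - S) (A - T)"
    using g assms(2) by (subst bij_betw_cong[of _ _ g]) (auto simp: q_def)
  with qS have "bij_betw q (S \<union> (A - S)) (T \<union> (A - T))"
    by (rule bij_betw_combine) auto
  then have "q permutes A"
    using assms(2,3) by (intro bij_imp_permutes) (auto simp: q_def Un_absorb1)
  then show ?thesis using qS by (auto simp: bij_betw_def)
qed

text \<open>Averaging over all \<open>k\<close>-subsets before averaging over permutations avoids counting the
  stabilizer of a subset.\<close>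

lemma sum_permutes_prod_eq_esym:
  fixes c :: "nat \<Rightarrow> 'a::{comm_ring_1, semiring_char_0}"
  assumes "k \<le> n"
  shows "of_nat (n choose k) * (\<Sum>p | p permutes {..<n}. \<Prod>l<k. c (p l))
    = fact n * esym {..<n} k c"
proof -
  let ?P = "{p. p permutes {..<n}}" and ?S = "{S. S \<subseteq> {..<n} \<and> card S = k}"
  have prod: "(\<Prod>x\<in>p ` S. c x) = (\<Prod>l\<in>S. c (p l))" if "p permutes {..<n}" for p S
    using permutes_inj_on[OF that] by (subst prod.reindex) auto
  \<comment> \<open>A permutation taking \<open>{..<k}\<close> to \<open>S\<close> merely reindexes
    the sum over the group.\<close>
  have indep: "(\<Sum>p\<in>?P. \<Prod>x\<in>p ` S. c x) = (\<Sum>p\<in>?P. \<Prod>l<k. c (p l))" if "S \<in> ?S" for S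
  proof -
    have "{..<k} \<subseteq> {..<n}" "S \<subseteq> {..<n}" "card {..<k} = card S"
      using that assms by auto
    then obtain q where q: "q permutes {..<n}" "q ` {..<k} = S"
      using permutes_image_eq_ex[of "{..<n}" "{..<k}" S] by blast
    have "(\<Sum>p\<in>?P. \<Prod>x\<in>p ` {..<k}. c x) = (\<Sum>p\<in>?P. \<Prod>x\<in>(p \<circ> q) ` {..<k}. c x)"
      by (rule sum_permutations_compose_right[OF q(1)])
    also have "\<dots> = (\<Sum>p\<in>?P. \<Prod>x\<in>p ` S. c x)"
      by (simp only: image_comp[symmetric] q(2))
    finally show ?thesis by (simp add: prod)
  qed
  \<comment> \<open>Each \<open>p\<close> permutes the \<open>k\<close>-subsets among
    themselves.\<close>
  have orbit_sum: "(\<Sum>S\<in>?S. \<Prod>x\<in>p ` S. c x) = esym {..<n} k c" if p: "p permutes {..<n}" for p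
    unfolding esym_def
  proof (rule sum.reindex_bij_witness[of _ "image (inv_into UNIV p)" "image p"])
    fix S assume S: "S \<in> ?S"
    show "inv_into UNIV p ` p ` S = S" "p ` inv_into UNIV p ` S = S"
      using p by (simp_all add: image_inv_f_f image_f_inv_f permutes_inj permutes_surj)
    show "p ` S \<in> ?S"
      using S permutes_image[OF p] card_image[OF permutes_inj_on[OF p]] by blast
    show "inv_into UNIV p ` S \<in> ?S"
      using S permutes_image[OF permutes_inv[OF p]] card_image[OF permutes_inj_on[OF permutes_inv[OF p]]]
      by blast
  qed auto
  have "of_nat (n choose k) * (\<Sum>p\<in>?P. \<Prod>l<k. c (p l)) = (\<Sum>S\<in>?S. \<Sum>p\<in>?P. \<Prod>x\<in>p ` S. c x)"
    by (simp add: indep n_subsets)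
  also have "\<dots> = (\<Sum>p\<in>?P. \<Sum>S\<in>?S. \<Prod>x\<in>p ` S. c x)"
    by (rule sum.swap)
  also have "\<dots> = fact n * esym {..<n} k c"
    by (simp add: orbit_sum card_permutations)
  finally show ?thesis .
qed

section \<open>The Weyl group in the basis of fundamental weights\<close>

text \<open>The rows are the simple coroots of type B, the dual basis of the fundamental
  weights.\<close>

definition inverse_weight_basis :: "nat \<Rightarrow> real mat" where
  "inverse_weight_basis n = mat n n (\<lambda>(k, i).
     if k + 1 < n then (if i = k then 1 else if i = k + 1 then - 1 else 0)
     else (if i = k then 2 else 0))"

definition signed_perm :: "nat \<Rightarrow> (nat \<Rightarrow> nat) \<Rightarrow> (nat \<Rightarrow> real) \<Rightarrow> real mat" where
  "signed_perm n p s = mat n n (\<lambda>(i, j). if i = p j then s j else 0)"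

lemma weight_mat_carrier [simp]:
  "weight_basis n \<in> carrier_mat n n"
  "inverse_weight_basis n \<in> carrier_mat n n"
  "signed_perm n p s \<in> carrier_mat n n"
  by (auto simp: weight_basis_def inverse_weight_basis_def signed_perm_def mat_of_cols_def)

lemma weight_mat_dim [simp]:
  "dim_row (weight_basis n) = n" "dim_col (weight_basis n) = n"
  "dim_row (inverse_weight_basis n) = n" "dim_col (inverse_weight_basis n) = n"
  "dim_row (signed_perm n p s) = n" "dim_col (signed_perm n p s) = n"
  using weight_mat_carrier carrier_matD by blast+

lemma weight_basis_index:
  assumes "i < n" and "j < n"
  shows "weight_basis n $$ (i, j) = (if j + 1 < n then if i \<le> j then 1 else 0 else 1 / 2)"
  using assms
  by (auto simp: weight_basis_def mat_of_cols_def fundamental_weight_def simp del: upt_Suc)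

lemma inverse_weight_basis_mult_index:
  assumes "A \<in> carrier_mat n m" and "k < n" and "j < m"
  shows "(inverse_weight_basis n * A) $$ (k, j)
    = (if k + 1 < n then A $$ (k, j) - A $$ (k + 1, j) else 2 * A $$ (k, j))"
proof -
  have "(inverse_weight_basis n * A) $$ (k, j)
      = (\<Sum>i<n. inverse_weight_basis n $$ (k, i) * A $$ (i, j))"
    using assms by (simp add: scalar_prod_def atLeast0LessThan)
  also have "\<dots> = (\<Sum>i<n.
      (if i = k then (if k + 1 < n then 1 else 2) * A $$ (k, j) else 0)
      + (if i = k + 1 then - A $$ (k + 1, j) else 0))"
    using assms by (intro sum.cong) (auto simp: inverse_weight_basis_def)
  finally show ?thesis using assms by (simp add: sum.distrib)
qed

lemma inverse_weight_basis:
  "inverse_weight_basis n * weight_basis n = 1\<^sub>m n"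
  "weight_basis n * inverse_weight_basis n = 1\<^sub>m n"
proof -
  show *: "inverse_weight_basis n * weight_basis n = 1\<^sub>m n"
    by (rule eq_matI)
      (auto simp: inverse_weight_basis_mult_index[where m = n] weight_basis_index simp del: index_mult_mat(1))
  show "weight_basis n * inverse_weight_basis n = 1\<^sub>m n"
    by (rule mat_mult_left_right_inverse[OF _ _ *]) auto
qed

lemma signed_perm_mult_index:
  assumes "p permutes {..<n}" and "A \<in> carrier_mat n m" and "i < n" and "j < m"
  shows "(signed_perm n p s * A) $$ (p i, j) = s i * A $$ (i, j)"
proof -
  have "p i < n" using permutes_in_image[OF assms(1)] assms(3) by simp
  have "(signed_perm n p s * A) $$ (p i, j) = (\<Sum>l<n. (if p i = p l then s l else 0) * A $$ (l, j))"
    using assms \<open>p i < n\<close>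
    by (auto simp: signed_perm_def scalar_prod_def atLeast0LessThan intro!: sum.cong)
  also have "\<dots> = (\<Sum>l<n. if l = i then s i * A $$ (i, j) else 0)"
    using permutes_inj[OF assms(1)] by (intro sum.cong) (auto dest: injD)
  finally show ?thesis using assms(3) by simp
qed

text \<open>The floor only changes the type: the entries are shown to be integers in
  \<open>of_int_int_signed_perm\<close>.\<close>

definition int_signed_perm :: "nat \<Rightarrow> (nat \<Rightarrow> nat) \<times> (nat \<Rightarrow> real) \<Rightarrow> int mat" where
  "int_signed_perm n = (\<lambda>(p, s). mat n n (\<lambda>(k, j).
     \<lfloor>(inverse_weight_basis n * (signed_perm n p s * weight_basis n)) $$ (k, j)\<rfloor>))"

text \<open>Extensional sign functions make the pair \<open>(p, s)\<close> unique for each group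
  element.\<close>

definition signed_perms :: "nat \<Rightarrow> ((nat \<Rightarrow> nat) \<times> (nat \<Rightarrow> real)) set" where
  "signed_perms n = {p. p permutes {..<n}} \<times> ({..<n} \<rightarrow>\<^sub>E {1, - 1})"

text \<open>The Weyl group preserves the weight lattice. A signed permutation of
  \<open>\<omega>_j\<close> has integer coordinates, except for the last weight, where all
  coordinates are \<open>1/2\<close> or \<open>-1/2\<close>; pairing with the coroots needs only
  differences and doubles of these.\<close>

lemma of_int_int_signed_perm:
  assumes ps: "(p, s) \<in> signed_perms n"
  shows "map_mat real_of_int (int_signed_perm n (p, s))
    = inverse_weight_basis n * (signed_perm n p s * weight_basis n)"
proof (rule eq_matI)
  let ?V = "signed_perm n p s * weight_basis n"
  let ?B = "inverse_weight_basis n * ?V"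
  have p: "p permutes {..<n}" and s: "\<And>l. l < n \<Longrightarrow> s l = 1 \<or> s l = - 1"
    using ps by (auto simp: signed_perms_def)
  have V: "\<exists>l<n. ?V $$ (k, j) = s l * weight_basis n $$ (l, j)" if "k < n" "j < n" for k j
  proof -
    have "k \<in> p ` {..<n}" using permutes_image[OF p] that by simp
    then obtain l where "l < n" "k = p l" by auto
    then show ?thesis
      using signed_perm_mult_index[OF p, of "weight_basis n" n l j s] that by auto
  qed
  fix k j assume "k < dim_row ?B" "j < dim_col ?B"
  then have kj: "k < n" "j < n" by (auto simp: inverse_weight_basis_def weight_basis_def)
  have B: "?B $$ (k, j) = (if k + 1 < n then ?V $$ (k, j) - ?V $$ (k + 1, j) else 2 * ?V $$ (k, j))"
    using kj by (intro inverse_weight_basis_mult_index[where m = n]) auto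
  have "?B $$ (k, j) \<in> \<int>"
  proof (cases "j + 1 < n")
    case True
    then have "?V $$ (k', j) \<in> \<int>" if "k' < n" for k'
      using V[OF that kj(2)] s kj(2) by (fastforce simp: weight_basis_index)
    then show ?thesis unfolding B using kj by auto
  next
    case False
    then have "?V $$ (k', j) = 1 / 2 \<or> ?V $$ (k', j) = - 1 / 2" if "k' < n" for k'
      using V[OF that kj(2)] s kj(2) by (fastforce simp: weight_basis_index)
    moreover have "2 * x \<in> \<int> \<and> x - y \<in> \<int>"
      if "x = 1 / 2 \<or> x = - 1 / 2" "y = 1 / 2 \<or> y = - 1 / 2" for x y :: real
      using that by (elim disjE; hypsubst; simp)
    ultimately show ?thesis unfolding B using kj by metis
  qed
  then show "map_mat real_of_int (int_signed_perm n (p, s)) $$ (k, j) = ?B $$ (k, j)"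
    using kj by (simp add: int_signed_perm_def del: index_mult_mat(1))
qed (auto simp: int_signed_perm_def inverse_weight_basis_def weight_basis_def)

lemma weight_basis_mult_int_signed_perm:
  assumes "(p, s) \<in> signed_perms n"
  shows "weight_basis n * map_mat real_of_int (int_signed_perm n (p, s))
    = signed_perm n p s * weight_basis n"
proof -
  have "weight_basis n * (inverse_weight_basis n * (signed_perm n p s * weight_basis n))
      = weight_basis n * inverse_weight_basis n * (signed_perm n p s * weight_basis n)"
    by (rule assoc_mult_mat[of _ n n _ n _ n, symmetric]) auto
  also have "\<dots> = signed_perm n p s * weight_basis n"
    by (simp add: inverse_weight_basis left_mult_one_mat[OF mult_carrier_mat])
  finally show ?thesis by (simp add: of_int_int_signed_perm assms)
qed

lemma integer_rep_B_eq: "integer_rep_B n = int_signed_perm n ` signed_perms n"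
proof (intro subset_antisym subsetI)
  fix B assume "B \<in> integer_rep_B n"
  then obtain p s where B: "B \<in> carrier_mat n n" and p: "p permutes {..<n}"
    and s: "\<forall>j<n. s j \<in> {1, - 1}"
    and eq: "signed_perm n p s * weight_basis n = weight_basis n * map_mat real_of_int B"
    by (auto simp: integer_rep_B_def weyl_group_B_def signed_perm_def)
  let ?s = "restrict s {..<n}"
  have sp: "signed_perm n p ?s = signed_perm n p s"
    by (rule eq_matI) (auto simp: signed_perm_def)
  have "inverse_weight_basis n * (weight_basis n * map_mat real_of_int B)
      = inverse_weight_basis n * weight_basis n * map_mat real_of_int B"
    using B by (intro assoc_mult_mat[of _ n n _ n _ n, symmetric]) auto
  then have "inverse_weight_basis n * (signed_perm n p ?s * weight_basis n) = map_mat real_of_int B"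
    using B by (simp add: sp eq inverse_weight_basis)
  then have "B = int_signed_perm n (p, ?s)"
    using B by (intro eq_matI) (auto simp: int_signed_perm_def simp del: index_mult_mat(1))
  moreover have "(p, ?s) \<in> signed_perms n"
    using p s by (auto simp: signed_perms_def)
  ultimately show "B \<in> int_signed_perm n ` signed_perms n" by blast
next
  fix B assume "B \<in> int_signed_perm n ` signed_perms n"
  then obtain p s where ps: "(p, s) \<in> signed_perms n" and B: "B = int_signed_perm n (p, s)"
    by auto
  have "signed_perm n p s \<in> weyl_group_B n"
    using ps by (auto simp: signed_perms_def weyl_group_B_def signed_perm_def)
  moreover have "B \<in> carrier_mat n n" by (simp add: B int_signed_perm_def)
  ultimately show "B \<in> integer_rep_B n"
    using weight_basis_mult_int_signed_perm[OF ps] by (auto simp: integer_rep_B_def B)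
qed

text \<open>Conjugation by the weight basis is injective, and column \<open>j\<close> of the signed
  permutation matrix reveals \<open>p j\<close> as the row of its nonzero entry and
  \<open>s j\<close> as the value.\<close>

lemma inj_on_int_signed_perm: "inj_on (int_signed_perm n) (signed_perms n)"
proof (rule inj_onI, clarify)
  fix p s p' s' assume ps: "(p, s) \<in> signed_perms n" and ps': "(p', s') \<in> signed_perms n"
    and eq: "int_signed_perm n (p, s) = int_signed_perm n (p', s')"
  have *: "signed_perm n p s * weight_basis n * inverse_weight_basis n = signed_perm n p s" for p s
    by (subst assoc_mult_mat[of _ n n _ n _ n])
      (auto simp: inverse_weight_basis intro!: right_mult_one_mat)
  have "signed_perm n p s * weight_basis n = signed_perm n p' s' * weight_basis n"
    using weight_basis_mult_int_signed_perm[OF ps] weight_basis_mult_int_signed_perm[OF ps'] eq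
    by simp
  then have eq: "signed_perm n p s = signed_perm n p' s'"
    using * by metis
  have p: "p permutes {..<n}" "p' permutes {..<n}"
    and s: "s \<in> {..<n} \<rightarrow>\<^sub>E {1, - 1}" "s' \<in> {..<n} \<rightarrow>\<^sub>E {1, - 1}"
    using ps ps' by (auto simp: signed_perms_def)
  have j: "p j = p' j \<and> s j = s' j" if "j < n" for j
  proof -
    have "p j < n" using permutes_in_image[OF p(1)] that by simp
    then have "s j = (if p j = p' j then s' j else 0)"
      using arg_cong[OF eq, of "\<lambda>A. A $$ (p j, j)"] that by (simp add: signed_perm_def)
    moreover have "s j \<noteq> 0" using PiE_mem[OF s(1), of j] that by auto
    ultimately show ?thesis by (auto split: if_splits)
  qed
  have "p = p'"
    proof
    show "p x = p' x" for x
      using j p by (cases "x < n") (simp_all add: permutes_not_in)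
  qed
  moreover have "s = s'"
    using j s by (intro PiE_ext) auto
  ultimately show "p = p' \<and> s = s'" by simp
qed

lemma card_integer_rep_B: "card (integer_rep_B n) = fact n * 2 ^ n"
  unfolding integer_rep_B_eq card_image[OF inj_on_int_signed_perm]
  by (simp add: signed_perms_def card_cartesian_product card_permutations card_PiE numeral_2_eq_2)

section \<open>Orbit sums in square-root coordinates\<close>

text \<open>Coordinate \<open>j\<close> of twice the fundamental weight with 0-based index
  \<open>i\<close>.\<close>

definition double_weight :: "nat \<Rightarrow> nat \<Rightarrow> nat \<Rightarrow> int" where
  "double_weight n i j = (if i + 1 < n then if j \<le> i then 2 else 0 else 1)"

text \<open>Since \<open>2\<omega>\<^sub>i\<close> is integral, the square roots \<open>u\<^sub>j\<close> of the characters of the \<open>\<epsilon>\<^sub>j\<close>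
  parametrize the torus of the weight lattice.\<close>

definition weight_point :: "nat \<Rightarrow> (nat \<Rightarrow> complex) \<Rightarrow> complex vec" where
  "weight_point n u = vec n (\<lambda>i. \<Prod>j<n. u j powi double_weight n i j)"

text \<open>On weight points the group acts by signed permutations of the \<open>u j\<close>: the
  exponent of \<open>u j\<close> is entry \<open>(j, i)\<close> of twice
  \<open>weight_basis n * B\<close>, which equals \<open>signed_perm n p s * weight_basis n\<close>.
  The product is then reindexed by \<open>j = p l\<close>.\<close>

lemma monomial_weight_point:
  assumes ps: "(p, s) \<in> signed_perms n" and "i < n" and u: "\<And>j. j < n \<Longrightarrow> u j \<noteq> 0"
  shows "monomial n (weight_point n u) (int_signed_perm n (p, s) *\<^sub>v unit_vec n i)
    = (\<Prod>l<n. u (p l) powi (if s l = 1 then double_weight n i l else - double_weight n i l))"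
proof -
  let ?B = "int_signed_perm n (p, s)"
  have p: "p permutes {..<n}" and s: "\<And>l. l < n \<Longrightarrow> s l = 1 \<or> s l = - 1"
    using ps by (auto simp: signed_perms_def)
  have B: "?B \<in> carrier_mat n n" by (simp add: int_signed_perm_def)
  have col: "(?B *\<^sub>v unit_vec n i) $ k = ?B $$ (k, i)" if "k < n" for k
    using that B \<open>i < n\<close> by simp
  have exponent: "(\<Sum>k<n. double_weight n k (p l) * ?B $$ (k, i))
      = (if s l = 1 then double_weight n i l else - double_weight n i l)" if "l < n" for l
  proof -
    have "p l < n" using permutes_in_image[OF p] that by simp
    have dw: "real_of_int (double_weight n k j) = 2 * weight_basis n $$ (j, k)"
      if "j < n" "k < n" for j k
      using that by (simp add: double_weight_def weight_basis_index)
    have "real_of_int (\<Sum>k<n. double_weight n k (p l) * ?B $$ (k, i))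
        = 2 * (weight_basis n * map_mat real_of_int ?B) $$ (p l, i)"
      using \<open>p l < n\<close> \<open>i < n\<close> B carrier_matD[OF weight_mat_carrier(1)[of n]]
      by (auto simp: scalar_prod_def atLeast0LessThan dw sum_distrib_left mult.assoc intro!: sum.cong)
    also have "\<dots> = 2 * (s l * weight_basis n $$ (l, i))"
      using that \<open>i < n\<close>
      by (simp add: weight_basis_mult_int_signed_perm[OF ps] signed_perm_mult_index[OF p, of _ n]
          del: index_mult_mat(1))
    also have "\<dots> = real_of_int (if s l = 1 then double_weight n i l else - double_weight n i l)"
      using s[OF that] dw[OF that \<open>i < n\<close>] by auto
    finally show ?thesis by (simp only: of_int_eq_iff)
  qed
  have powi_sum: "(\<Prod>k\<in>K. a powi f k) = a powi (\<Sum>k\<in>K. f k)" if "a \<noteq> 0"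
    for a :: complex and f :: "nat \<Rightarrow> int" and K
    using that by (induct K rule: infinite_finite_induct) (auto simp: power_int_add)
  have powi_prod: "(\<Prod>k\<in>K. f k) powi m = (\<Prod>k\<in>K. f k powi m)"
    for f :: "nat \<Rightarrow> complex" and K m
    by (induct K rule: infinite_finite_induct) (auto simp: power_int_mult_distrib)
  have "monomial n (weight_point n u) (?B *\<^sub>v unit_vec n i)
      = (\<Prod>k<n. \<Prod>j<n. u j powi (double_weight n k j * ?B $$ (k, i)))"
    unfolding monomial_def
    by (intro prod.cong)
      (simp_all add: col weight_point_def powi_prod power_int_mult del: index_mult_mat_vec)
  also have "\<dots> = (\<Prod>j<n. u j powi (\<Sum>k<n. double_weight n k j * ?B $$ (k, i)))"
    by (subst prod.swap) (simp add: powi_sum u)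
  also have "\<dots> = (\<Prod>l<n. u (p l) powi (\<Sum>k<n. double_weight n k (p l) * ?B $$ (k, i)))"
    by (rule prod.permute[OF p, unfolded comp_def])
  finally show ?thesis by (simp add: exponent)
qed

text \<open>The sum over signs factors into terms \<open>a + inverse a = 2 * Re a\<close>, as each
  \<open>a\<close> has modulus 1. The remaining sum over permutations is an elementary symmetric
  polynomial for \<open>i + 1 < n\<close> and has constant summands for the last weight.\<close>

lemma theta_weight_point:
  assumes "i < n" and u: "\<And>j. j < n \<Longrightarrow> cmod (u j) = 1"
  shows "theta n (i + 1) (weight_point n u) = of_real
    (if i + 1 < n then esym {..<n} (i + 1) (\<lambda>j. Re ((u j)\<^sup>2)) / (n choose (i + 1))
     else \<Prod>j<n. Re (u j))"
proof -
  let ?P = "{p. p permutes {..<n}}" and ?E = "{..<n} \<rightarrow>\<^sub>E {1, - 1 :: real}"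
  have u0: "u j \<noteq> 0" if "j < n" for j using u[OF that] by auto
  let ?e = "\<lambda>(p :: nat \<Rightarrow> nat) (s :: real) l.
    u (p l) powi (if s = 1 then double_weight n i l else - double_weight n i l)"
  have "(\<Sum>B\<in>integer_rep_B n. monomial n (weight_point n u) (B *\<^sub>v unit_vec n i))
      = (\<Sum>(p, s)\<in>signed_perms n. \<Prod>l<n. ?e p (s l) l)"
    unfolding integer_rep_B_eq sum.reindex[OF inj_on_int_signed_perm] comp_def
    by (intro sum.cong refl) (use monomial_weight_point[OF _ \<open>i < n\<close>] u0 in auto)
  also have "\<dots> = (\<Sum>p\<in>?P. \<Sum>s\<in>?E. \<Prod>l<n. ?e p (s l) l)"
    unfolding signed_perms_def by (rule sum.cartesian_product[symmetric])
  also have "\<dots> = (\<Sum>p\<in>?P. \<Prod>l<n. \<Sum>s\<in>{1, - 1}. ?e p s l)"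
    by (subst prod_sum_PiE) auto
  also have "\<dots> = (\<Sum>p\<in>?P. 2 ^ n * of_real (\<Prod>l<n. Re (u (p l) powi double_weight n i l)))"
  proof (rule sum.cong[OF refl])
    fix p assume "p \<in> ?P"
    then have p: "p l < n" if "l < n" for l using that permutes_in_image by fastforce
    have "(\<Sum>s\<in>{1, - 1}. ?e p s l) = 2 * of_real (Re (u (p l) powi double_weight n i l))"
      if "l < n" for l
    proof -
      have "inverse (u (p l) powi double_weight n i l) = cnj (u (p l) powi double_weight n i l)"
        using u[OF p[OF that]] divide_conv_cnj[of "u (p l) powi double_weight n i l" 1]
        by (simp add: inverse_eq_divide norm_power_int)
      then show ?thesis
        using complex_add_cnj[of "u (p l) powi double_weight n i l"] by (simp add: power_int_minus)
    qed
    then show "(\<Prod>l<n. \<Sum>s\<in>{1, - 1}. ?e p s l)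
        = 2 ^ n * of_real (\<Prod>l<n. Re (u (p l) powi double_weight n i l))"
      by (simp add: prod.distrib)
  qed
  finally have "theta n (i + 1) (weight_point n u)
      = of_real ((\<Sum>p\<in>?P. \<Prod>l<n. Re (u (p l) powi double_weight n i l)) / fact n)"
    by (simp add: theta_def card_integer_rep_B sum_distrib_left[symmetric] field_simps)
  moreover have "(\<Sum>p\<in>?P. \<Prod>l<n. Re (u (p l) powi double_weight n i l)) / fact n
    = (if i + 1 < n then esym {..<n} (i + 1) (\<lambda>j. Re ((u j)\<^sup>2)) / (n choose (i + 1))
     else \<Prod>j<n. Re (u j))"
  proof (cases "i + 1 < n")
    case True
    have "(\<Prod>l<n. Re (u (p l) powi double_weight n i l)) = (\<Prod>l<i+1. Re ((u (p l))\<^sup>2))" for p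
    proof -
      have "(\<Prod>l<i+1. Re ((u (p l))\<^sup>2)) = (\<Prod>l<i+1. Re (u (p l) powi double_weight n i l))"
        using True by (intro prod.cong) (auto simp: double_weight_def)
      also have "\<dots> = (\<Prod>l<n. Re (u (p l) powi double_weight n i l))"
        using True by (intro prod.mono_neutral_left) (auto simp: double_weight_def)
      finally show ?thesis by simp
    qed
    moreover have "real (n choose (i + 1)) > 0" using True by (simp del: binomial_Suc_Suc)
    ultimately show ?thesis
      using sum_permutes_prod_eq_esym[of "i + 1" n "\<lambda>j. Re ((u j)\<^sup>2)"] True
      by (simp add: field_simps del: binomial_Suc_Suc)
  next
    case False
    have "(\<Prod>l<n. Re (u (p l) powi double_weight n i l)) = (\<Prod>j<n. Re (u j))" if "p \<in> ?P" for p
      using False prod.permute[of p "{..<n}" "\<lambda>j. Re (u j)"] that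
      by (simp add: double_weight_def comp_def)
    then show ?thesis using False by (simp add: card_permutations)
  qed
  ultimately show ?thesis by (simp only:)
qed

section \<open>The orbit space\<close>

text \<open>The conditions for \<open>k < n\<close> only cancel signs. Given these, the sum inside
  \<open>coeff_c n n z\<close> supplies all but the top term of the expansion of
  \<open>\<Prod>j<n. 1 + c j\<close>.\<close>

lemma coeff_c_eq_esym_iff:
  fixes z :: "real vec"
  assumes "n > 0"
  shows "(\<forall>k. 1 \<le> k \<longrightarrow> k \<le> n \<longrightarrow> coeff_c n k z = (- 1) ^ k * esym {..<n} k c) \<longleftrightarrow>
    (\<forall>k. 1 \<le> k \<longrightarrow> k < n \<longrightarrow> (n choose k) * z $ (k - 1) = esym {..<n} k c)
    \<and> 2 ^ n * (z $ (n - 1))\<^sup>2 = (\<Prod>j<n. 1 + c j)" (is "?L \<longleftrightarrow> ?R1 \<and> ?R2")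
proof -
  let ?S = "\<Sum>k = 1..n - 1. (n choose k) * z $ (k - 1)"
  have "?L \<longleftrightarrow> (\<forall>k. 1 \<le> k \<longrightarrow> k < n \<longrightarrow> coeff_c n k z = (- 1) ^ k * esym {..<n} k c)
      \<and> coeff_c n n z = (- 1) ^ n * esym {..<n} n c"
    using assms by (metis Suc_leI One_nat_def le_less)
  moreover have "coeff_c n k z = (- 1) ^ k * esym {..<n} k c
      \<longleftrightarrow> (n choose k) * z $ (k - 1) = esym {..<n} k c" if "k < n" for k
    using that by (simp add: coeff_c_def mult.assoc)
  moreover have "coeff_c n n z = (- 1) ^ n * esym {..<n} n c \<longleftrightarrow>
      2 ^ n * (z $ (n - 1))\<^sup>2 - ?S - 1 = esym {..<n} n c"
    by (simp add: coeff_c_def)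
  moreover have "2 ^ n * (z $ (n - 1))\<^sup>2 - ?S - 1 = esym {..<n} n c
      \<longleftrightarrow> 2 ^ n * (z $ (n - 1))\<^sup>2 = (\<Prod>j<n. 1 + c j)" if ?R1
  proof -
    have "{..n} = insert 0 (insert n {1..n - 1})" using assms by auto
    then have "(\<Prod>j<n. 1 + c j) = 1 + (\<Sum>k = 1..n - 1. esym {..<n} k c) + esym {..<n} n c"
      using assms prod_one_plus_eq_sum_esym[of "{..<n}" c] by (simp add: esym_0)
    also have "(\<Sum>k = 1..n - 1. esym {..<n} k c) = ?S"
      using that assms by (intro sum.cong) auto
    finally show ?thesis by linarith
  qed
  ultimately show ?thesis by blast
qed

section \<open>Parametrization of the torus and of the orbit spaces\<close>

lemma weight_point_index:
  assumes "i < n"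
  shows "weight_point n u $ i = (if i + 1 < n then \<Prod>j\<le>i. (u j)\<^sup>2 else \<Prod>j<n. u j)"
proof (cases "i + 1 < n")
  case True
  have "(\<Prod>j\<le>i. (u j)\<^sup>2) = (\<Prod>j\<le>i. u j powi double_weight n i j)"
    using True by (intro prod.cong) (auto simp: double_weight_def)
  also have "\<dots> = (\<Prod>j<n. u j powi double_weight n i j)"
    using True by (intro prod.mono_neutral_left) (auto simp: double_weight_def)
  finally show ?thesis using True by (simp add: weight_point_def)
next
  case False
  then show ?thesis using assms by (simp add: weight_point_def double_weight_def)
qed

lemma torus_eq_weight_points:
  assumes "n > 0"
  shows "torus n = weight_point n ` {u. \<forall>j<n. cmod (u j) = 1}"
proof (intro subset_antisym subsetI)
  fix x assume x: "x \<in> torus n"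
  then have norm: "cmod (x $ j) = 1" if "j < n" for j using that by (simp add: torus_def)
  have dim: "dim_vec x = n"
    using x by (simp add: torus_def carrier_vecD)
  \<comment> \<open>For \<open>j + 1 < n\<close> the quotient of consecutive coordinates is the
    character of a standard basis vector, and \<open>u j\<close> is a square root of it. The last
    \<open>u j\<close> is then forced by the product that has to equal the last coordinate.\<close>
  define y where "y j = (if j = 0 then x $ 0 else x $ j / x $ (j - 1))" for j
  define Q where "Q = (\<Prod>i<n - 1. csqrt (y i))"
  define u where "u j = (if j + 1 < n then csqrt (y j) else x $ j / Q)" for j
  have y: "cmod (y j) = 1" if "j < n" for j
    using that norm by (simp add: y_def norm_divide)
  have prod_y: "(\<Prod>j\<le>i. y j) = x $ i" if "i < n" for i
    using that
  proof (induct i)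
    case (Suc i)
    then have "x $ i \<noteq> 0" using norm[of i] by auto
    then show ?case using Suc by (simp add: y_def)
  qed (simp add: y_def)
  have norm_Q: "cmod Q = 1"
    using y by (simp add: Q_def prod_norm[symmetric])
  then have "Q \<noteq> 0" by auto
  have "weight_point n u = x"
  proof (rule eq_vecI)
    fix i assume "i < dim_vec x"
    then have "i < n" by (simp only: dim)
    show "weight_point n u $ i = x $ i"
    proof (cases "i + 1 < n")
      case True
      then have "(\<Prod>j\<le>i. (u j)\<^sup>2) = (\<Prod>j\<le>i. y j)"
        by (intro prod.cong) (auto simp: u_def)
      then show ?thesis using True by (simp add: weight_point_index prod_y)
    next
      case False
      then have n: "n = Suc i" using \<open>i < n\<close> by simp
      have "(\<Prod>j<n. u j) = (\<Prod>j<i. u j) * u i"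
        by (simp add: n)
      also have "(\<Prod>j<i. u j) = Q"
        unfolding Q_def by (intro prod.cong) (auto simp: n u_def)
      also have "Q * u i = x $ i"
        using \<open>Q \<noteq> 0\<close> False by (simp add: u_def)
      finally show ?thesis using False \<open>i < n\<close> by (simp add: weight_point_index)
    qed
  qed (simp add: dim weight_point_def)
  moreover have "cmod (u j) = 1" if "j < n" for j
    by (cases "j + 1 < n") (simp_all add: u_def norm_divide y norm norm_Q that)
  ultimately show "x \<in> weight_point n ` {u. \<forall>j<n. cmod (u j) = 1}" by blast
next
  fix x assume "x \<in> weight_point n ` {u. \<forall>j<n. cmod (u j) = 1}"
  then show "x \<in> torus n"
    by (auto simp: torus_def weight_point_def prod_norm[symmetric] norm_power_int)
qed

text \<open>The value of \<open>theta_map\<close> at \<open>weight_point n u\<close>, as a real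
  vector, so that both orbit spaces become images of the same set.\<close>

definition orbit_point :: "nat \<Rightarrow> (nat \<Rightarrow> complex) \<Rightarrow> real vec" where
  "orbit_point n u = vec n (\<lambda>i.
     if i + 1 < n then esym {..<n} (i + 1) (\<lambda>j. Re ((u j)\<^sup>2)) / (n choose (i + 1))
     else \<Prod>j<n. Re (u j))"

lemma theta_map_weight_point:
  assumes "\<And>j. j < n \<Longrightarrow> cmod (u j) = 1"
  shows "theta_map n (weight_point n u) = map_vec of_real (orbit_point n u)"
  using theta_weight_point[OF _ assms]
  by (intro eq_vecI) (auto simp: theta_map_def orbit_point_def)

lemma orbit_spaces_eq_orbit_points:
  assumes "n > 0"
  shows "real_orbit_space n = orbit_point n ` {u. \<forall>j<n. cmod (u j) = 1}"
    and "orbit_space n = map_vec of_real ` orbit_point n ` {u. \<forall>j<n. cmod (u j) = 1}"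
proof -
  let ?U = "{u. \<forall>j<n. cmod (u j) = 1}"
  have th: "theta_map n (weight_point n u) = map_vec of_real (orbit_point n u)" if "u \<in> ?U" for u
    using that by (simp add: theta_map_weight_point)
  have "map_vec Re (map_vec of_real z) = z" for z :: "real vec"
    by (rule eq_vecI) auto
  then show "real_orbit_space n = orbit_point n ` ?U"
    unfolding real_orbit_space_def torus_eq_weight_points[OF assms] image_image
    by (intro image_cong) (simp_all add: th)
  show "orbit_space n = map_vec of_real ` orbit_point n ` ?U"
    unfolding orbit_space_def torus_eq_weight_points[OF assms] image_image
    by (intro image_cong) (simp_all add: th)
qed

section \<open>Orbit points and the semidefinite condition\<close>

lemma two_mult_Re_power2:
  assumes "cmod w = 1"
  shows "2 * (Re w)\<^sup>2 = 1 + Re (w\<^sup>2)"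
  using assms cmod_power2[of w] by (simp add: power2_eq_square algebra_simps)

lemma prod_Re_power2:
  assumes "\<And>j. j < n \<Longrightarrow> cmod (u j) = 1"
  shows "2 ^ n * (\<Prod>j<n. Re (u j))\<^sup>2 = (\<Prod>j<n. 1 + Re ((u j)\<^sup>2))"
proof -
  have "2 ^ n * (\<Prod>j<n. Re (u j))\<^sup>2 = (\<Prod>j<n. 2 * (Re (u j))\<^sup>2)"
    by (simp add: prod.distrib prod_power_distrib)
  then show ?thesis using assms by (simp add: two_mult_Re_power2)
qed

lemma orbit_points_eq_pos_semidef:
  assumes "n > 0"
  shows "orbit_point n ` {u. \<forall>j<n. cmod (u j) = 1}
    = {z \<in> carrier_vec n. pos_semidef (hermite_H n z)}"
proof (intro subset_antisym subsetI)
  fix z assume "z \<in> orbit_point n ` {u. \<forall>j<n. cmod (u j) = 1}"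
  then obtain u where u: "\<And>j. j < n \<Longrightarrow> cmod (u j) = 1" and z: "z = orbit_point n u"
    by auto
  let ?c = "\<lambda>j. Re ((u j)\<^sup>2)"
  have dim: "dim_vec z = n" by (simp add: z orbit_point_def)
  have "(n choose k) * z $ (k - 1) = esym {..<n} k ?c" if "1 \<le> k" "k < n" for k
    using that by (simp add: z orbit_point_def)
  moreover have "2 ^ n * (z $ (n - 1))\<^sup>2 = (\<Prod>j<n. 1 + ?c j)"
    using assms prod_Re_power2[of n u] u by (simp only: z orbit_point_def) simp
  ultimately have zc: "\<forall>k. 1 \<le> k \<longrightarrow> k \<le> n \<longrightarrow> coeff_c n k z = (- 1) ^ k * esym {..<n} k ?c"
    unfolding coeff_c_eq_esym_iff[OF assms] by blast
  have c: "\<bar>?c j\<bar> \<le> 1" if "j < n" for j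
    using u[OF that] abs_Re_le_cmod[of "(u j)\<^sup>2"] by (simp only: norm_power) simp
  have "pos_semidef (hermite_H n z)"
    unfolding pos_semidef_hermite_H_iff[OF assms dim]
    by (rule exI[of _ ?c], rule conjI[OF _ zc]) (intro allI impI c)
  then show "z \<in> {z \<in> carrier_vec n. pos_semidef (hermite_H n z)}"
    using carrier_vecI[OF dim] by (intro CollectI conjI)
next
  fix z :: "real vec" assume "z \<in> {z \<in> carrier_vec n. pos_semidef (hermite_H n z)}"
  then have dim: "dim_vec z = n" and psd: "pos_semidef (hermite_H n z)"
    by (simp_all only: mem_Collect_eq carrier_vecD)
  obtain c where c: "\<And>j. j < n \<Longrightarrow> \<bar>c j\<bar> \<le> 1"
    and zc: "\<forall>k. 1 \<le> k \<longrightarrow> k \<le> n \<longrightarrow> coeff_c n k z = (- 1) ^ k * esym {..<n} k c"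
    using iffD1[OF pos_semidef_hermite_H_iff[OF assms dim] psd] by blast
  note zk = conjunct1[OF zc[unfolded coeff_c_eq_esym_iff[OF assms]]]
    and zn = conjunct2[OF zc[unfolded coeff_c_eq_esym_iff[OF assms]]]
  have point: "orbit_point n u = z" if "\<And>j. j < n \<Longrightarrow> Re ((u j)\<^sup>2) = c j"
    and "(\<Prod>j<n. Re (u j)) = z $ (n - 1)" for u
  proof (rule eq_vecI)
    fix i assume "i < dim_vec z"
    then have "i < n" by (simp add: dim)
    show "orbit_point n u $ i = z $ i"
    proof (cases "i + 1 < n")
      case True
      have "esym {..<n} (i + 1) (\<lambda>j. Re ((u j)\<^sup>2)) = esym {..<n} (i + 1) c"
        unfolding esym_def by (intro sum.cong prod.cong refl) (use that(1) in auto)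
      also have "\<dots> = (n choose (i + 1)) * z $ i"
        using spec[OF zk, of "i + 1"] True by simp
      finally show ?thesis
        using True by (simp add: orbit_point_def del: binomial_Suc_Suc)
    next
      case False
      then have "i = n - 1" using \<open>i < n\<close> by simp
      then show ?thesis using False \<open>i < n\<close> that(2) by (simp add: orbit_point_def)
    qed
  qed (simp add: orbit_point_def dim)
  \<comment> \<open>Half the angle of \<open>c j\<close>: the square of \<open>u j\<close> is
    \<open>cis (arccos (c j))\<close>, with real part \<open>c j\<close>.\<close>
  define u where "u j = cis (arccos (c j) / 2)" for j
  have sq: "Re ((u j)\<^sup>2) = c j" if "j < n" for j
    using c[OF that] by (simp add: u_def DeMoivre cos_arccos_abs)
  have norm_u: "cmod (u j) = 1" for j
    by (simp add: u_def)
  have "2 ^ n * (\<Prod>j<n. Re (u j))\<^sup>2 = (\<Prod>j<n. 1 + Re ((u j)\<^sup>2))"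
    by (rule prod_Re_power2) (rule norm_u)
  also have "\<dots> = 2 ^ n * (z $ (n - 1))\<^sup>2"
    unfolding zn by (intro prod.cong refl) (simp add: sq)
  finally have "(\<Prod>j<n. Re (u j))\<^sup>2 = (z $ (n - 1))\<^sup>2" by simp
  then consider "(\<Prod>j<n. Re (u j)) = z $ (n - 1)" | "(\<Prod>j<n. Re (u j)) = - z $ (n - 1)"
    by (auto simp: power2_eq_iff)
  then show "z \<in> orbit_point n ` {u. \<forall>j<n. cmod (u j) = 1}"
  proof cases
    case 1
    then have "z = orbit_point n u" using point sq by metis
    then show ?thesis by (auto simp: u_def)
  next
    case 2
    \<comment> \<open>The roots fix the last coordinate of \<open>z\<close> only up to sign.
      Negating one \<open>u j\<close> flips the product of the real parts and keeps all
      squares.\<close>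
    let ?u = "u(0 := - u 0)"
    have split: "{..<n} = insert 0 {1..<n}" using assms by auto
    have "(\<Prod>j<n. Re (?u j)) = - (\<Prod>j<n. Re (u j))"
      unfolding split by simp
    then have "(\<Prod>j<n. Re (?u j)) = z $ (n - 1)" using 2 by simp
    moreover have "Re ((?u j)\<^sup>2) = c j" if "j < n" for j
      using sq[OF that] by auto
    ultimately have "z = orbit_point n ?u" using point by metis
    then show ?thesis by (auto simp: u_def)
  qed
qed

theorem theorem6p4:
  fixes n :: nat
  assumes "n \<ge> 2"
  shows "orbit_space n = map_vec complex_of_real ` real_orbit_space n
    \<and> real_orbit_space n = {z \<in> carrier_vec n. pos_semidef (hermite_H n z)}"
proof -
  have "n > 0" using assms by simp
  note orbit_spaces_eq_orbit_points[OF this]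
  then show ?thesis using orbit_points_eq_pos_semidef[OF \<open>n > 0\<close>] by simp
qed

end
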